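(* Let $a$ be a positive integer, let $r$ be the largest integer such that $r^2\mid a$, and let $\delta\in(0,\frac12)$ be real. Then \[ A(a,\delta)\ll \delta a(\log a)\,d(a)+\sigma(r), \] where the implied constant is absolute.
   Context: For real $t$, $\|t\|=\min_{n\in\mathbb{Z}}|t-n|$ is the distance from $t$ to the nearest integer. For a positive integer $a$ and real $\delta>0$, $A(a,\delta)$ is the number of integers $x$ with $1\le x\le a$ and $\left\|\frac{x^2}{a}\right\|\le\delta$. For a positive integer $n$, $d(n)=\sum_{m\mid n}1$ is the number of positive divisors of $n$ and $\sigma(n)=\sum_{m\mid n}m$ is their sum. $\log$ is the natural logarithm. The notation $f\ll g$ means that there is a constant $C$ with $|f|\le C|g|$ for all admissible values of the parameters (here $a$ and $\delta$). *)

theory Defs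
  imports "HOL-Analysis.Analysis"
begin

definition dist_int :: "real \<Rightarrow> real" where
  "dist_int t = (INF n::int. \<bar>t - of_int n\<bar>)"

text \<open>The infimum is attained, so it is a minimum.\<close>

lemma dist_int_eq_round: "dist_int t = \<bar>t - of_int (round t)\<bar>"
  unfolding dist_int_def
  by (rule cInf_eq_minimum) (auto intro: round_diff_minimal)

definition A :: "nat \<Rightarrow> real \<Rightarrow> nat" where
  "A a \<delta> = card {x::nat. 1 \<le> x \<and> x \<le> a \<and> dist_int (real (x ^ 2) / real a) \<le> \<delta>}"

text \<open>The next two are meant for \<open>n > 0\<close> only: for \<open>n = 0\<close> the index set is infinite.\<close>

definition divisor_count :: "nat \<Rightarrow> nat" where
  "divisor_count n = (\<Sum>m | m dvd n. 1)"

definition divisor_sum :: "nat \<Rightarrow> nat" where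
  "divisor_sum n = (\<Sum>m | m dvd n. m)"

end

theory Submission
  imports Defs "HOL-Number_Theory.Cong"
begin

text \<open>
  If \<open>x\<close> and \<open>y\<close> are both square roots of \<open>m\<close> modulo \<open>a\<close>, then \<open>a\<close> divides \<open>(x - y) (x + y)\<close>,
  so with \<open>d = gcd (x - y) a\<close> we have \<open>x \<equiv> y (mod d)\<close> and \<open>x \<equiv> - y (mod a / d)\<close>. For each \<open>d\<close>
  there are at most \<open>g = gcd d (a / d)\<close> such \<open>x\<close> modulo \<open>a\<close>, and if there is one at all then
  \<open>g\<close> divides \<open>2 y\<close>, whence \<open>g\<^sup>2\<close> divides \<open>4 m\<close>. At most \<open>8 M / g\<^sup>2\<close> nonzero \<open>m\<close> with
  \<open>\<bar>m\<bar> \<le> M\<close> satisfy this, so summing over \<open>m\<close> first bounds the contribution of each divisor \<open>d\<close> by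
  \<open>8 M / g \<le> 8 M\<close>. The residue \<open>m = 0\<close> has exactly \<open>r\<close> square roots, and \<open>r \<le> \<sigma> r\<close>. If a nonzero
  residue occurs then \<open>a \<ge> 3\<close>, so that \<open>ln a \<ge> 1\<close>.
\<close>

section \<open>Square roots of a fixed residue modulo \<open>a\<close>\<close>

text \<open>The representatives run from 1 to \<open>a\<close>, the range of \<open>x\<close> in
  \<open>A\<close>; \<open>m\<close> is an integer because residues of both signs near 0
  occur.\<close>

definition sqrts_mod :: "nat \<Rightarrow> int \<Rightarrow> int set" where
  "sqrts_mod a m = {x \<in> {1..int a}. [x\<^sup>2 = m] (mod int a)}"

lemma finite_sqrts_mod [simp]: "finite (sqrts_mod a m)"
  unfolding sqrts_mod_def by (rule finite_subset[of _ "{1..int a}"]) auto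

text \<open>The interval splits into \<open>g\<close> blocks of \<open>L\<close> consecutive
  integers, and no block contains two distinct integers congruent modulo \<open>L\<close>. The
  blocks start at 1, hence the shift by 1 before dividing.\<close>

lemma card_pairwise_cong_le:
  fixes L :: int and g :: nat and X :: "int set"
  assumes "L > 0" "X \<subseteq> {1..int g * L}"
    and cong: "\<And>x y. x \<in> X \<Longrightarrow> y \<in> X \<Longrightarrow> [x = y] (mod L)"
  shows "card X \<le> g"
proof -
  have "inj_on (\<lambda>x. (x - 1) div L) X"
  proof (rule inj_onI)
    fix x y assume "x \<in> X" "y \<in> X" and div_eq: "(x - 1) div L = (y - 1) div L"
    have "[x - 1 = y - 1] (mod L)"
      using cong[OF \<open>x \<in> X\<close> \<open>y \<in> X\<close>] by (simp add: cong_diff)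
    then have "(x - 1) mod L = (y - 1) mod L"
      by (simp add: cong_def)
    with div_eq have "x - 1 = y - 1"
      by (metis div_mult_mod_eq)
    then show "x = y" by simp
  qed
  moreover have "(\<lambda>x. (x - 1) div L) ` X \<subseteq> {0..<int g}"
  proof
    fix z assume "z \<in> (\<lambda>x. (x - 1) div L) ` X"
    then obtain x where x: "x \<in> X" "z = (x - 1) div L" by blast
    then have "0 \<le> x - 1" "x - 1 < int g * L" using assms(2) by auto
    moreover have "(x - 1) div L * L \<le> x - 1"
      using div_mult_mod_eq[of "x - 1" L] pos_mod_sign[OF \<open>L > 0\<close>, of "x - 1"] by linarith
    ultimately have "(x - 1) div L * L < int g * L" by linarith
    then have "z < int g" using \<open>L > 0\<close> x by simp
    then show "z \<in> {0..<int g}"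
      using \<open>L > 0\<close> \<open>0 \<le> x - 1\<close> x by (simp add: pos_imp_zdiv_nonneg_iff)
  qed
  ultimately have "card X \<le> card {0..<int g}"
    by (intro card_inj_on_le) auto
  then show ?thesis by simp
qed

text \<open>Any two solutions agree modulo the lcm of \<open>d\<close> and \<open>a div d\<close>.
  Since gcd times lcm is \<open>a\<close>, the range \<open>{1..int a}\<close> consists of exactly
  gcd many periods.\<close>

lemma card_cong_pair_le:
  fixes a d :: nat
  assumes "a > 0" "d dvd a"
  shows "card {x \<in> {1..int a}. [x = b] (mod int d) \<and> [x = c] (mod int (a div d))} \<le> gcd d (a div d)"
proof (rule card_pairwise_cong_le[where L = "lcm (int d) (int (a div d))"])
  have pos: "d > 0" "a div d > 0"
    using assms by (auto simp: dvd_div_eq_0_iff intro!: Nat.gr0I)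
  then show "lcm (int d) (int (a div d)) > 0"
    by (simp add: lcm_pos_nat)
  have "gcd d (a div d) * lcm d (a div d) = a"
    using assms by (simp flip: prod_gcd_lcm_nat)
  then have "int (gcd d (a div d)) * lcm (int d) (int (a div d)) = int a"
    by (metis lcm_int_int_eq of_nat_mult)
  then show "{x \<in> {1..int a}. [x = b] (mod int d) \<and> [x = c] (mod int (a div d))}
      \<subseteq> {1..int (gcd d (a div d)) * lcm (int d) (int (a div d))}" by auto
next
  fix x y
  assume "x \<in> {x \<in> {1..int a}. [x = b] (mod int d) \<and> [x = c] (mod int (a div d))}"
    "y \<in> {x \<in> {1..int a}. [x = b] (mod int d) \<and> [x = c] (mod int (a div d))}"
  then have "[x = y] (mod int d)" "[x = y] (mod int (a div d))"
    by (metis (mono_tags, lifting) cong_sym cong_trans mem_Collect_eq)+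
  then show "[x = y] (mod lcm (int d) (int (a div d)))"
    unfolding cong_iff_dvd_diff by (rule lcm_least)
qed

text \<open>With \<open>g\<close> the gcd, g^2 divides 4 y^2 because \<open>g\<close> divides 2 y =
  (x + y) - (x - y). As g^2 also divides \<open>a\<close>, y^2 may be replaced by
  \<open>m\<close>.\<close>

lemma gcd_cofactor_sq_dvd_four_mult:
  fixes a d :: nat
  assumes "d dvd a" "[x = y] (mod int d)" "[x = - y] (mod int (a div d))" "[y\<^sup>2 = m] (mod int a)"
  shows "int ((gcd d (a div d))\<^sup>2) dvd 4 * m"
proof -
  define g where "g = gcd d (a div d)"
  have "g * g dvd d * (a div d)"
    unfolding g_def by (intro mult_dvd_mono) auto
  then have g_a: "int (g\<^sup>2) dvd int a"
    using assms(1) by (simp add: power2_eq_square flip: of_nat_mult)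
  have "int g dvd x - y" "int g dvd x + y"
    using assms(2,3) unfolding cong_iff_dvd_diff g_def
    by (auto intro: dvd_trans[of _ "int d"] dvd_trans[of _ "int (a div d)"])
  then have "int g dvd (x + y) - (x - y)" by (rule dvd_diff[rotated])
  then have "int g dvd 2 * y" by simp
  then have "(int g)\<^sup>2 dvd (2 * y)\<^sup>2" by (rule dvd_power_same)
  moreover have "int (g\<^sup>2) dvd 4 * (y\<^sup>2 - m)"
    using g_a assms(4) by (metis cong_iff_dvd_diff dvd_mult dvd_trans)
  ultimately have "int (g\<^sup>2) dvd (2 * y)\<^sup>2 - 4 * (y\<^sup>2 - m)"
    by (intro dvd_diff) simp_all
  then show ?thesis by (simp add: g_def algebra_simps)
qed

text \<open>One root \<open>y\<close> is fixed and the roots \<open>x\<close> are sorted by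
  \<open>d = gcd (x - y) a\<close>. The divisibility condition is kept in the summand because it
  makes large gcds rare once \<open>m\<close> varies.\<close>

lemma card_sqrts_mod_le:
  assumes "a > 0"
  shows "card (sqrts_mod a m) \<le>
    (\<Sum>d | d dvd a. if int ((gcd d (a div d))\<^sup>2) dvd 4 * m then gcd d (a div d) else 0)"
proof (cases "sqrts_mod a m = {}")
  case False
  then obtain y where y: "[y\<^sup>2 = m] (mod int a)" unfolding sqrts_mod_def by blast
  define X where
    "X d = {x \<in> {1..int a}. [x = y] (mod int d) \<and> [x = - y] (mod int (a div d))}" for d
  have fin: "finite {d. d dvd a}" using assms by simp
  have "sqrts_mod a m \<subseteq> (\<Union>d\<in>{d. d dvd a}. X d)"
  proof
    fix x assume "x \<in> sqrts_mod a m"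
    then have x: "x \<in> {1..int a}" "[x\<^sup>2 = m] (mod int a)" by (auto simp: sqrts_mod_def)
    define d where "d = nat (gcd (x - y) (int a))"
    have d: "int d = gcd (x - y) (int a)" by (simp add: d_def)
    then have "d dvd a" by (metis gcd_dvd2 int_dvd_int_iff)
    have "int a dvd x\<^sup>2 - y\<^sup>2"
      using x(2) y by (metis cong_iff_dvd_diff cong_sym cong_trans)
    then have "int a dvd (x - y) * (x + y)" by (simp add: power2_eq_square algebra_simps)
    \<comment> \<open>\<open>a\<close> divides both (x + y)(x - y) and (x + y) a, hence their gcd |x
      + y| d; cancelling \<open>d\<close> leaves \<open>a div d\<close> dividing x + y.\<close>
    then have "int a dvd gcd ((x + y) * (x - y)) ((x + y) * int a)"
      by (intro gcd_greatest) (simp_all add: mult.commute)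
    also have "\<dots> = \<bar>x + y\<bar> * int d"
      unfolding d by (rule gcd_mult_distrib_int[symmetric])
    finally have "int d * int (a div d) dvd int d * \<bar>x + y\<bar>"
      using \<open>d dvd a\<close> by (simp add: mult.commute flip: of_nat_mult)
    moreover have "d \<noteq> 0" using \<open>d dvd a\<close> assms by auto
    ultimately have "int (a div d) dvd x + y" by simp
    moreover have "int d dvd x - y" by (simp add: d)
    ultimately have "x \<in> X d" using x(1) by (simp add: X_def cong_iff_dvd_diff)
    with \<open>d dvd a\<close> show "x \<in> (\<Union>d\<in>{d. d dvd a}. X d)" by blast
  qed
  then have "card (sqrts_mod a m) \<le> card (\<Union>d\<in>{d. d dvd a}. X d)"
    using fin by (intro card_mono finite_UN_I)
      (auto simp: X_def intro: finite_subset[of _ "{1..int a}"])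
  also have "\<dots> \<le> (\<Sum>d | d dvd a. card (X d))"
    using fin by (rule card_UN_le)
  also have "\<dots> \<le> (\<Sum>d | d dvd a.
      if int ((gcd d (a div d))\<^sup>2) dvd 4 * m then gcd d (a div d) else 0)"
  proof (rule sum_mono)
    fix d assume "d \<in> {d. d dvd a}"
    then have d: "d dvd a" by simp
    show "card (X d) \<le> (if int ((gcd d (a div d))\<^sup>2) dvd 4 * m then gcd d (a div d) else 0)"
    proof (cases "X d = {}")
      case False
      then obtain x where "[x = y] (mod int d)" "[x = - y] (mod int (a div d))"
        unfolding X_def by blast
      then have "int ((gcd d (a div d))\<^sup>2) dvd 4 * m"
        using gcd_cofactor_sq_dvd_four_mult[OF d _ _ y] by blast
      then show ?thesis
        using card_cong_pair_le[OF assms d] by (simp add: X_def)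
    qed simp
  qed
  finally show ?thesis .
qed simp

section \<open>Summing over the nonzero residues\<close>

text \<open>The quotients 4 m / k are distinct nonzero integers of absolute value at most 4 M / k,
  so there are at most twice that many.\<close>

lemma card_dvd_four_mult_le:
  fixes k :: nat and M :: nat
  assumes "k > 0"
  shows "card {m \<in> {- int M..int M} - {0}. int k dvd 4 * m} * k \<le> 8 * M"
proof -
  define q where "q = 4 * M div k"
  let ?S = "{m \<in> {- int M..int M} - {0}. int k dvd 4 * m}"
  have "inj_on (\<lambda>m. 4 * m div int k) ?S"
    using assms by (auto intro!: inj_onI simp: dvd_div_eq_iff)
  moreover have "(\<lambda>m. 4 * m div int k) ` ?S \<subseteq> {- int q..int q} - {0}"
  proof
    fix z assume "z \<in> (\<lambda>m. 4 * m div int k) ` ?S"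
    then obtain m where m: "\<bar>m\<bar> \<le> int M" "m \<noteq> 0" "4 * m = z * int k"
      using assms by (elim imageE) (simp add: abs_le_iff)
    then have "\<bar>z\<bar> * int k \<le> int (4 * M)" by (simp add: abs_mult flip: abs_mult[of z "int k"])
    then have "nat \<bar>z\<bar> * k \<le> 4 * M" by (simp add: nat_le_iff flip: of_nat_le_iff[where 'a = int])
    then have "nat \<bar>z\<bar> \<le> q" using assms by (simp add: q_def less_eq_div_iff_mult_less_eq)
    then have "\<bar>z\<bar> \<le> int q" by simp
    then show "z \<in> {- int q..int q} - {0}" using m by auto
  qed
  ultimately have "card ?S \<le> card ({- int q..int q} - {0})"
    by (intro card_inj_on_le) auto
  also have "\<dots> = 2 * q" by (simp add: card_Diff_singleton)
  finally have "card ?S * k \<le> 2 * (q * k)" by simp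
  also have "\<dots> \<le> 2 * (4 * M)" unfolding q_def by (intro mult_left_mono) auto
  finally show ?thesis by simp
qed

lemma sum_card_sqrts_mod_nonzero_le:
  assumes "a > 0"
  shows "(\<Sum>m\<in>{- int M..int M} - {0}. card (sqrts_mod a m)) \<le> 8 * M * divisor_count a"
proof -
  let ?I = "{- int M..int M} - {0::int}"
  let ?g = "\<lambda>d. gcd d (a div d)"
  have "(\<Sum>m\<in>?I. card (sqrts_mod a m)) \<le>
      (\<Sum>m\<in>?I. \<Sum>d | d dvd a. if int ((?g d)\<^sup>2) dvd 4 * m then ?g d else 0)"
    by (intro sum_mono card_sqrts_mod_le assms)
  also have "\<dots> = (\<Sum>d | d dvd a. \<Sum>m\<in>?I. if int ((?g d)\<^sup>2) dvd 4 * m then ?g d else 0)"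
    by (rule sum.swap)
  also have "\<dots> = (\<Sum>d | d dvd a. card {m \<in> ?I. int ((?g d)\<^sup>2) dvd 4 * m} * ?g d)"
    by (intro sum.cong refl) (simp add: sum.If_cases Int_def)
  also have "\<dots> \<le> (\<Sum>d | d dvd a. 8 * M)"
  proof (rule sum_mono)
    fix d assume "d \<in> {d. d dvd a}"
    then have "?g d > 0" using assms by (metis gcd_pos_nat mem_Collect_eq dvd_0_left_iff not_gr_zero)
    \<comment> \<open>Raising the weight from g to g^2 matches the modulus g^2 in the count, so the
      bound becomes independent of \<open>d\<close>.\<close>
    then have "card {m \<in> ?I. int ((?g d)\<^sup>2) dvd 4 * m} * ?g d
        \<le> card {m \<in> ?I. int ((?g d)\<^sup>2) dvd 4 * m} * (?g d)\<^sup>2"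
      by (intro mult_left_mono) (simp_all add: power2_eq_square Suc_le_eq del: gcd_pos_nat)
    also have "\<dots> \<le> 8 * M"
      using \<open>?g d > 0\<close> by (intro card_dvd_four_mult_le) simp
    finally show "card {m \<in> ?I. int ((?g d)\<^sup>2) dvd 4 * m} * ?g d \<le> 8 * M" .
  qed
  also have "\<dots> = 8 * M * divisor_count a" by (simp add: divisor_count_def)
  finally show ?thesis .
qed

section \<open>The residue zero\<close>

text \<open>Maximality of \<open>r\<close> makes the cofactor \<open>k\<close> in a = r^2 k
  squarefree. Hence every root of 0 is a multiple of r k, and \<open>{1..int a}\<close> has length r
  (r k).\<close>

lemma card_sqrts_mod_zero_le:
  fixes a r :: nat
  assumes "a > 0" "r\<^sup>2 dvd a" and max: "\<And>s. s\<^sup>2 dvd a \<Longrightarrow> s \<le> r"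
  shows "card (sqrts_mod a 0) \<le> r"
proof -
  obtain k where k: "a = r\<^sup>2 * k" using assms(2) by blast
  then have pos: "r > 0" "k > 0" using assms(1) by (auto intro!: Nat.gr0I)
  have k_dvd: "k dvd y" if "k dvd y\<^sup>2" for y
  proof -
    \<comment> \<open>Here \<open>e\<close> is the gcd of \<open>k\<close> and \<open>y\<close>.
      Coprimality of \<open>f\<close> and \<open>z\<close> will force \<open>f\<close> to divide
      \<open>e\<close>, so that f^2 divides \<open>k\<close> and maximality of \<open>r\<close>
      gives f = 1.\<close>
    obtain e f z where e: "k = e * f" "y = e * z" "coprime f z" "e > 0"
      using gcd_coprime_exists[of k y] pos by (metis gcd_eq_0_iff gr0I mult.commute neq0_conv)
    with that have "e * f dvd e * (e * z\<^sup>2)"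
      by (simp add: power2_eq_square mult_ac)
    then have "f dvd e * z\<^sup>2" using e by simp
    then have "f dvd e" using e by (simp add: coprime_dvd_mult_left_iff)
    then have "f\<^sup>2 dvd k" by (simp add: e power2_eq_square)
    then have "(r * f)\<^sup>2 dvd a" by (simp add: k power_mult_distrib)
    from max[OF this] have "f \<le> 1" using pos by simp
    moreover have "f \<noteq> 0" using pos e by auto
    ultimately have "f = 1" by simp
    then show ?thesis by (simp add: e)
  qed
  have dvd: "int (r * k) dvd x" if "x \<in> sqrts_mod a 0" for x
  proof -
    have "int a dvd x\<^sup>2" using that by (simp add: sqrts_mod_def cong_0_iff)
    then have a_dvd: "a dvd (nat \<bar>x\<bar>)\<^sup>2"
      by (metis abs_ge_zero int_dvd_int_iff int_nat_eq of_nat_power power2_abs)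
    then have "r\<^sup>2 dvd (nat \<bar>x\<bar>)\<^sup>2" using assms(2) dvd_trans by blast
    then obtain y where y: "nat \<bar>x\<bar> = r * y" by (metis dvdE pos2 pow_divides_pow_iff)
    with a_dvd have "k dvd y\<^sup>2" using pos by (simp add: k power_mult_distrib)
    then have "r * k dvd nat \<bar>x\<bar>" by (simp add: y k_dvd)
    then show ?thesis by (metis abs_ge_zero dvd_abs_iff int_dvd_int_iff int_nat_eq)
  qed
  show ?thesis
  proof (rule card_pairwise_cong_le[where L = "int (r * k)"])
    show "sqrts_mod a 0 \<subseteq> {1..int r * int (r * k)}"
      by (auto simp: sqrts_mod_def k power2_eq_square mult.assoc)
    show "[x = y] (mod int (r * k))" if "x \<in> sqrts_mod a 0" "y \<in> sqrts_mod a 0" for x y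
      using dvd[OF that(1)] dvd[OF that(2)] by (simp add: cong_iff_dvd_diff)
  qed (use pos in simp)
qed

section \<open>From fractional parts to residues\<close>

text \<open>If n is the integer nearest to x^2 / a, then m = x^2 - n a is a residue of x^2 with |m|
  at most \<delta> a.\<close>

lemma A_le_sum_card_sqrts_mod:
  assumes "a > 0"
  shows "A a \<delta> \<le> (\<Sum>m\<in>{- int (nat \<lfloor>\<delta> * real a\<rfloor>)..int (nat \<lfloor>\<delta> * real a\<rfloor>)}. card (sqrts_mod a m))"
proof -
  define M where "M = nat \<lfloor>\<delta> * real a\<rfloor>"
  let ?S = "{x::nat. 1 \<le> x \<and> x \<le> a \<and> dist_int (real (x ^ 2) / real a) \<le> \<delta>}"
  have "int ` ?S \<subseteq> (\<Union>m\<in>{- int M..int M}. sqrts_mod a m)"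
  proof
    fix z assume "z \<in> int ` ?S"
    then obtain x where x: "z = int x" "1 \<le> x" "x \<le> a"
      and dist: "dist_int (real (x ^ 2) / real a) \<le> \<delta>" by blast
    define n where "n = round (real (x ^ 2) / real a)"
    define m where "m = z\<^sup>2 - n * int a"
    have "\<bar>real (x ^ 2) / real a - of_int n\<bar> * real a \<le> \<delta> * real a"
      using dist by (intro mult_right_mono) (simp_all add: dist_int_eq_round n_def)
    also have "\<bar>real (x ^ 2) / real a - of_int n\<bar> * real a
        = \<bar>(real (x ^ 2) / real a - of_int n) * real a\<bar>" by (simp add: abs_mult)
    also have "(real (x ^ 2) / real a - of_int n) * real a = of_int m"
      using assms by (simp add: m_def x(1) field_simps)
    finally have "\<bar>m\<bar> \<le> \<lfloor>\<delta> * real a\<rfloor>" by (simp add: le_floor_iff)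
    \<comment> \<open>The floor is at least |m|, hence nonnegative, so \<open>nat\<close> does not
      truncate it.\<close>
    then have "\<bar>m\<bar> \<le> int M" unfolding M_def by linarith
    then have "m \<in> {- int M..int M}" by (simp add: abs_le_iff)
    moreover have "z \<in> sqrts_mod a m"
      using x by (simp add: sqrts_mod_def m_def cong_iff_dvd_diff)
    ultimately show "z \<in> (\<Union>m\<in>{- int M..int M}. sqrts_mod a m)" by blast
  qed
  then have "card (int ` ?S) \<le> card (\<Union>m\<in>{- int M..int M}. sqrts_mod a m)"
    by (intro card_mono) auto
  also have "\<dots> \<le> (\<Sum>m\<in>{- int M..int M}. card (sqrts_mod a m))"
    by (rule card_UN_le) simp
  finally show ?thesis by (simp add: A_def M_def card_image)
qed

theorem theorem4:
  shows "\<exists>C::real. \<forall>(a::nat) (r::nat) (\<delta>::real).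
           a > 0 \<longrightarrow> r ^ 2 dvd a \<longrightarrow> (\<forall>s::nat. s ^ 2 dvd a \<longrightarrow> s \<le> r) \<longrightarrow>
           0 < \<delta> \<longrightarrow> \<delta> < 1 / 2 \<longrightarrow>
           \<bar>real (A a \<delta>)\<bar> \<le> C * \<bar>\<delta> * real a * ln (real a) * real (divisor_count a)
                                + real (divisor_sum r)\<bar>"
\<comment> \<open>The 8 comes from the nonzero residues; the zero residue costs only a factor
  1.\<close>
proof (intro exI[of _ 8] allI impI)
  fix a r :: nat and \<delta> :: real
  assume a: "a > 0" and r: "r ^ 2 dvd a" and max: "\<forall>s::nat. s ^ 2 dvd a \<longrightarrow> s \<le> r"
    and \<delta>: "0 < \<delta>" "\<delta> < 1 / 2"
  define M where "M = nat \<lfloor>\<delta> * real a\<rfloor>"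
  define D where "D = real (divisor_count a)"
  have M: "real M \<le> \<delta> * real a" using \<delta> by (simp add: M_def)
  have "r > 0" using a r by (auto intro!: Nat.gr0I)
  then have r_le: "r \<le> divisor_sum r"
    unfolding divisor_sum_def by (intro member_le_sum) auto
  have ln: "0 \<le> ln (real a)" using a by simp
  \<comment> \<open>For \<open>a\<close> equal to 1 or 2 the logarithm is below 1, but then \<delta>
    a < 1 and M = 0.\<close>
  have M_le: "real M \<le> \<delta> * real a * ln (real a)"
  proof (cases "M = 0")
    case True
    then show ?thesis using \<delta> ln by simp
  next
    case False
    then have "1 \<le> \<delta> * real a" using M by linarith
    also have "\<dots> < real a / 2" using \<delta> a by simp
    finally have "a \<ge> 3" by linarith
    then have "exp 1 \<le> real a" using e_less_272 by linarith
    then have "1 \<le> ln (real a)" using a by (simp add: ln_ge_iff)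
    then have "\<delta> * real a * 1 \<le> \<delta> * real a * ln (real a)"
      using \<delta> by (intro mult_left_mono) auto
    then show ?thesis using M by simp
  qed
  have "A a \<delta> \<le> (\<Sum>m\<in>{- int M..int M}. card (sqrts_mod a m))"
    unfolding M_def by (rule A_le_sum_card_sqrts_mod[OF a])
  also have "\<dots> = card (sqrts_mod a 0) + (\<Sum>m\<in>{- int M..int M} - {0}. card (sqrts_mod a m))"
    by (rule sum.remove) auto
  also have "\<dots> \<le> divisor_sum r + 8 * M * divisor_count a"
    using card_sqrts_mod_zero_le[OF a r] max r_le
    by (intro add_mono sum_card_sqrts_mod_nonzero_le a) (meson le_trans)
  finally have "real (A a \<delta>) \<le> real (divisor_sum r + 8 * M * divisor_count a)"
    by (rule of_nat_mono)
  also have "\<dots> = real (divisor_sum r) + 8 * (real M * D)" by (simp add: D_def)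
  also have "\<dots> \<le> real (divisor_sum r) + 8 * (\<delta> * real a * ln (real a) * D)"
    using M_le by (intro add_left_mono mult_left_mono mult_right_mono) (auto simp: D_def)
  also have "\<dots> \<le> 8 * (\<delta> * real a * ln (real a) * D + real (divisor_sum r))" by simp
  also have "\<dots> \<le> 8 * \<bar>\<delta> * real a * ln (real a) * D + real (divisor_sum r)\<bar>"
    by (intro mult_left_mono abs_ge_self) simp
  finally show "\<bar>real (A a \<delta>)\<bar> \<le> 8 * \<bar>\<delta> * real a * ln (real a) * real (divisor_count a)
                                + real (divisor_sum r)\<bar>" by (simp add: D_def)
qed

end
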